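(* Let $\alpha>0$ be a non-singular degree for $(\Gamma,\theta)$, let $\rho:V(\Gamma)\to\mathbb{R}$, and let $f:C(\Gamma,\theta)\to\mathbb{R}$ be the homogeneous harmonic function of degree $\alpha$ determined by $\rho$. Enumerate $V(\Gamma)=\{v_i\}$ and write $\rho_i=\rho(v_i)$, $\theta_{ij}=\theta(v_iv_j)$. Then $f$ is balanced if and only if for each vertex $v_i$, $$\sum_{v_j\sim v_i}\frac{\rho_j-\cos(\alpha\theta_{ij})\rho_i}{\sin(\alpha\theta_{ij})}=0.$$
   Context: $\Gamma$ is a finite connected simplicial graph (no loops or multiple edges) with vertex set $V(\Gamma)$ and edge set $E(\Gamma)$; $v\sim w$ means $v,w$ are adjacent. $\theta:E(\Gamma)\to(0,\pi)$ is a function. For an angle $\theta_0$, $S_{\theta_0}=\{(r,\theta): r\ge 0,\ 0\le\theta\le\theta_0\}$ is the Euclidean plane sector in polar coordinates. The cone $C(\Gamma)=(\Gamma\times[0,\infty))/\!\sim$ collapses $\Gamma\times\{0\}$ to a point (the vertex of the cone). $C(\Gamma,\theta)$ is $C(\Gamma)$ with the metric for which each face $C(e)$, $e\in E(\Gamma)$, is isometric to $S_{\theta(e)}$: identifying $e$ with $[0,1]$, the point $(x,t)\in C(e)$ corresponds to the polar coordinates $(r,\theta)=(t,x\theta(e))$. If $v$ is an endpoint of $e$, the coordinates on $C(e)$ adapted to $v$ are those where $v$ corresponds to $0\in[0,1]$, so that the edge $C(v)=\{v\}\times[0,\infty)$ is the ray $\theta=0$. A homogeneous function $f:C(\Gamma,\theta)\to\mathbb{R}$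 of degree $\alpha>0$ is one of the form $f(x,t)=\rho(x)t^\alpha$ with $\rho:\Gamma\to\mathbb{R}$ continuous. It is harmonic if its restriction to each face $C(e)$, expressed in the polar coordinates $(r,\theta)=(t,x\theta(e))$ identifying $C(e)$ with $S_{\theta(e)}$, is a harmonic function in the interior of the plane sector $S_{\theta(e)}$. It is balanced along $C(v)$ ($v\in V(\Gamma)$) if $\sum_j\frac{\partial u_j}{\partial\theta}(r,0)=0$ for all $r>0$, where $e_j$ runs over the edges incident to $v$ and $u_j$ is $f|_{C(e_j)}$ expressed in coordinates adapted to $v$; it is balanced if it is balanced along $C(v)$ for every $v\in V(\Gamma)$. A degree $\alpha>0$ is singular if $\alpha\theta(e)\in\pi\mathbb{Z}$ for some $e\in E(\Gamma)$, and non-singular otherwise. For non-singular $\alpha$, each $\rho:V(\Gamma)\to\mathbb{R}$ determines a unique homogeneous harmonic function $f$ of degree $\alpha$ with $f(v,1)=\rho(v)$ for all $v\in V(\Gamma)$; this is the function determined by $\rho$. *)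

theory Defs
  imports "Graph_Theory.Digraph_Component" "HOL-Analysis.Analysis"
begin

text \<open>
  A finite simplicial graph is a \<^locale>\<open>pair_graph\<close>: an undirected edge between \<open>u\<close> and
  \<open>v\<close> appears as the two arcs \<open>(u, v)\<close> and \<open>(v, u)\<close>, which stand for the two identifications
  of that edge with the unit interval. Functions on edges, such as the angle function \<open>\<theta>\<close>,
  take the unordered pair \<open>{u, v}\<close> as argument.
\<close>

definition edge_set :: "'v pair_pre_digraph \<Rightarrow> 'v set set" where
  "edge_set G = {{u, v} | u v. (u, v) \<in> parcs G}"

definition neighbours :: "'v pair_pre_digraph \<Rightarrow> 'v \<Rightarrow> 'v set" where
  "neighbours G v = {w. (v, w) \<in> parcs G}"


text \<open>
  Points of the topological graph are given by their barycentric coordinates. The topology is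
  the one induced by the product topology on \<^typ>\<open>'v \<Rightarrow> real\<close>; for a finite graph this is the
  usual topology of the 1-complex.
\<close>

type_synonym 'v graph_point = "'v \<Rightarrow> real"

definition vertex_point :: "'v \<Rightarrow> 'v graph_point" where
  "vertex_point v = indicator {v}"

definition edge_point :: "'v \<Rightarrow> 'v \<Rightarrow> real \<Rightarrow> 'v graph_point" where
  "edge_point u v s = (\<lambda>w. (1 - s) * vertex_point u w + s * vertex_point v w)"

definition realization :: "'v pair_pre_digraph \<Rightarrow> 'v graph_point set" where
  "realization G = vertex_point ` pverts G \<union>
     {edge_point u v s | u v s. (u, v) \<in> parcs G \<and> 0 \<le> s \<and> s \<le> 1}"


text \<open>The cone is the set of equivalence classes of \<open>cone_rel\<close>.\<close>

type_synonym 'v cone_point = "('v graph_point \<times> real) set"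

definition cone_rel ::
  "'v pair_pre_digraph \<Rightarrow> (('v graph_point \<times> real) \<times> ('v graph_point \<times> real)) set" where
  "cone_rel G = {(p, q). p \<in> realization G \<times> {0..} \<and> q \<in> realization G \<times> {0..} \<and>
     (p = q \<or> snd p = 0 \<and> snd q = 0)}"

definition cone :: "'v pair_pre_digraph \<Rightarrow> 'v cone_point set" where
  "cone G = (realization G \<times> {0..}) // cone_rel G"

definition cone_pt :: "'v pair_pre_digraph \<Rightarrow> 'v graph_point \<Rightarrow> real \<Rightarrow> 'v cone_point" where
  "cone_pt G x t = cone_rel G `` {(x, t)}"

lemma cone_eq: "cone G = {cone_pt G x t | x t. x \<in> realization G \<and> 0 \<le> t}"
  by (force simp: cone_def cone_pt_def quotient_def)


text \<open>
  Sectors live in the Euclidean plane \<^typ>\<open>complex\<close>. For \<open>\<theta>\<^sub>0 < pi\<close> the polar angle of a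
  point of \<open>sector \<theta>\<^sub>0\<close> is its \<^const>\<open>Arg\<close>.
\<close>

definition sector :: "real \<Rightarrow> complex set" where
  "sector \<theta>\<^sub>0 = {rcis r \<phi> | r \<phi>. 0 \<le> r \<and> 0 \<le> \<phi> \<and> \<phi> \<le> \<theta>\<^sub>0}"

text \<open>
  The angle function enters through the following charts, which put the polar coordinates of
  \<open>sector (\<theta> {u, v})\<close> on the face over the edge \<open>{u, v}\<close>. They are the coordinates adapted to
  \<open>u\<close>, i.e. \<open>u\<close> corresponds to the ray \<open>\<phi> = 0\<close>.
\<close>

definition face_pt ::
  "'v pair_pre_digraph \<Rightarrow> ('v set \<Rightarrow> real) \<Rightarrow> 'v \<Rightarrow> 'v \<Rightarrow> real \<Rightarrow> real \<Rightarrow> 'v cone_point" where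
  "face_pt G \<theta> u v r \<phi> = cone_pt G (edge_point u v (\<phi> / \<theta> {u, v})) r"

definition homogeneous ::
  "'v pair_pre_digraph \<Rightarrow> real \<Rightarrow> ('v cone_point \<Rightarrow> real) \<Rightarrow> bool" where
  "homogeneous G \<alpha> f \<longleftrightarrow> 0 < \<alpha> \<and>
     (\<exists>\<rho>. continuous_on (realization G) \<rho> \<and>
       (\<forall>x\<in>realization G. \<forall>t\<ge>0. f (cone_pt G x t) = \<rho> x * t powr \<alpha>))"


definition partial_deriv ::
  "'e::euclidean_space \<Rightarrow> ('e \<Rightarrow> real) \<Rightarrow> 'e \<Rightarrow> real" where
  "partial_deriv b h z = frechet_derivative h (at z) b"

definition C2_on :: "'e::euclidean_space set \<Rightarrow> ('e \<Rightarrow> real) \<Rightarrow> bool" where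
  "C2_on U h \<longleftrightarrow> open U \<and> h differentiable_on U \<and>
     (\<forall>b\<in>Basis. partial_deriv b h differentiable_on U \<and>
       (\<forall>c\<in>Basis. continuous_on U (partial_deriv c (partial_deriv b h))))"

definition laplacian :: "('e::euclidean_space \<Rightarrow> real) \<Rightarrow> 'e \<Rightarrow> real" where
  "laplacian h z = (\<Sum>b\<in>Basis. partial_deriv b (partial_deriv b h) z)"

definition harmonic_on :: "'e::euclidean_space set \<Rightarrow> ('e \<Rightarrow> real) \<Rightarrow> bool" where
  "harmonic_on U h \<longleftrightarrow> C2_on U h \<and> (\<forall>z\<in>U. laplacian h z = 0)"


text \<open>
  Running over all arcs imposes the condition on every face, in both of its identifications
  with a sector; these differ by a reflection of the sector.
\<close>

definition harmonic ::
  "'v pair_pre_digraph \<Rightarrow> ('v set \<Rightarrow> real) \<Rightarrow> ('v cone_point \<Rightarrow> real) \<Rightarrow> bool" where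
  "harmonic G \<theta> f \<longleftrightarrow> (\<forall>(u, v)\<in>parcs G.
     harmonic_on (interior (sector (\<theta> {u, v}))) (\<lambda>z. f (face_pt G \<theta> u v (cmod z) (Arg z))))"

text \<open>
  The angular derivatives at the ray \<open>\<phi> = 0\<close> are one-sided, and their existence is part of the
  condition.
\<close>

definition balanced_along ::
  "'v pair_pre_digraph \<Rightarrow> ('v set \<Rightarrow> real) \<Rightarrow> ('v cone_point \<Rightarrow> real) \<Rightarrow> 'v \<Rightarrow> bool" where
  "balanced_along G \<theta> f v \<longleftrightarrow> (\<forall>r>0. \<exists>D.
     (\<forall>w\<in>neighbours G v. ((\<lambda>\<phi>. f (face_pt G \<theta> v w r \<phi>)) has_real_derivative D w)
        (at 0 within {0..\<theta> {v, w}})) \<and>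
     (\<Sum>w\<in>neighbours G v. D w) = 0)"

definition balanced ::
  "'v pair_pre_digraph \<Rightarrow> ('v set \<Rightarrow> real) \<Rightarrow> ('v cone_point \<Rightarrow> real) \<Rightarrow> bool" where
  "balanced G \<theta> f \<longleftrightarrow> (\<forall>v\<in>pverts G. balanced_along G \<theta> f v)"

definition singular_degree ::
  "'v pair_pre_digraph \<Rightarrow> ('v set \<Rightarrow> real) \<Rightarrow> real \<Rightarrow> bool" where
  "singular_degree G \<theta> \<alpha> \<longleftrightarrow> (\<exists>e\<in>edge_set G. \<exists>k::int. \<alpha> * \<theta> e = of_int k * pi)"

definition determined_by :: "'v pair_pre_digraph \<Rightarrow> ('v set \<Rightarrow> real) \<Rightarrow> real \<Rightarrow>
    ('v \<Rightarrow> real) \<Rightarrow> ('v cone_point \<Rightarrow> real) \<Rightarrow> bool" where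
  "determined_by G \<theta> \<alpha> \<rho> f \<longleftrightarrow> homogeneous G \<alpha> f \<and> harmonic G \<theta> f \<and>
     (\<forall>v\<in>pverts G. f (cone_pt G (vertex_point v) 1) = \<rho> v)"

end

theory Submission
  imports Defs
begin

text \<open>
  On a face a homogeneous function has the form \<open>g(\<phi>) r\<^sup>\<alpha>\<close>, and the Laplacian in polar
  coordinates turns harmonicity into \<open>g'' = - \<alpha>\<^sup>2 g\<close>. Hence \<open>g\<close> is the combination of
  \<open>cos (\<alpha> \<phi>)\<close> and \<open>sin (\<alpha> \<phi>)\<close> with the prescribed values at the two ends of the edge, and its
  derivative at \<open>0\<close> is \<open>\<alpha>\<close> times the summand in the vertex condition.
\<close>

section \<open>Polar derivatives through Cartesian partial derivatives\<close>

lemma has_derivative_partial_deriv_complex: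
  fixes h :: "complex \<Rightarrow> real"
  assumes "h differentiable (at z)"
  shows "(h has_derivative (\<lambda>d. Re d * partial_deriv 1 h z + Im d * partial_deriv \<i> h z)) (at z)"
proof -
  have D: "(h has_derivative frechet_derivative h (at z)) (at z)"
    using assms by (simp add: frechet_derivative_works)
  interpret D: bounded_linear "frechet_derivative h (at z)"
    using D by (rule has_derivative_bounded_linear)
  have "frechet_derivative h (at z) d = Re d * partial_deriv 1 h z + Im d * partial_deriv \<i> h z" for d
  proof -
    have "d = Re d *\<^sub>R 1 + Im d *\<^sub>R \<i>"
      by (simp add: complex_eq_iff)
    then have "frechet_derivative h (at z) d = frechet_derivative h (at z) (Re d *\<^sub>R 1 + Im d *\<^sub>R \<i>)"
      by simp
    then show ?thesis
      by (simp only: D.add D.scaleR partial_deriv_def real_scaleR_def)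
  qed
  then have "frechet_derivative h (at z) =
      (\<lambda>d. Re d * partial_deriv 1 h z + Im d * partial_deriv \<i> h z)" by (rule ext)
  with D show ?thesis by simp
qed

text \<open>Chain rule. Applied to rays and to the unit circle, it expresses radial and angular
  derivatives by the partial derivatives in the directions \<open>1\<close> and
  \<open>\<i>\<close>.\<close>

lemma has_real_derivative_along_curve:
  fixes h :: "complex \<Rightarrow> real"
  assumes "h differentiable (at (\<gamma> t))" "(\<gamma> has_vector_derivative \<gamma>') (at t)"
  shows "((\<lambda>t. h (\<gamma> t)) has_real_derivative
    Re \<gamma>' * partial_deriv 1 h (\<gamma> t) + Im \<gamma>' * partial_deriv \<i> h (\<gamma> t)) (at t)"
proof -
  have "((\<lambda>t. h (\<gamma> t)) has_derivative (\<lambda>s. Re (s *\<^sub>R \<gamma>') * partial_deriv 1 h (\<gamma> t)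
      + Im (s *\<^sub>R \<gamma>') * partial_deriv \<i> h (\<gamma> t))) (at t)"
    using has_derivative_compose[OF assms(2)[unfolded has_vector_derivative_def]
        has_derivative_partial_deriv_complex[OF assms(1)]] .
  moreover have "(\<lambda>s. Re (s *\<^sub>R \<gamma>') * partial_deriv 1 h (\<gamma> t)
      + Im (s *\<^sub>R \<gamma>') * partial_deriv \<i> h (\<gamma> t)) =
      (*) (Re \<gamma>' * partial_deriv 1 h (\<gamma> t) + Im \<gamma>' * partial_deriv \<i> h (\<gamma> t))"
    by (auto simp: algebra_simps)
  ultimately show ?thesis
    by (simp add: has_field_derivative_def)
qed

lemma has_vector_derivative_rcis_radius: "((\<lambda>r. rcis r \<phi>) has_vector_derivative cis \<phi>) (at r)"
  unfolding rcis_def by (auto intro!: derivative_eq_intros)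

text \<open>The tangent of the unit circle is the radius turned by a right angle; the addition
  formulas reduce its components to \<open>- sin \<phi>\<close> and
  \<open>cos \<phi>\<close>.\<close>

lemma has_vector_derivative_cis: "(cis has_vector_derivative rcis 1 (\<phi> + pi / 2)) (at \<phi>)"
proof -
  have "rcis 1 (\<phi> + pi / 2) = Complex (- sin \<phi>) (cos \<phi>)"
    by (simp add: complex_eq_iff cos_add sin_add)
  then show ?thesis
    unfolding has_vector_derivative_complex_iff
    by (auto intro!: derivative_eq_intros simp: has_real_derivative_iff_has_vector_derivative[symmetric])
qed

section \<open>The differential equation of the angular profile\<close>

text \<open>On the unit circle the Laplacian is the sum of the second radial, the first radial and
  the second angular derivative. Homogeneity makes the first two \<alpha>(\<alpha> - 1) g and
  \<alpha> g, with sum \<alpha>^2 g.\<close>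

lemma homogeneous_harmonic_ode:
  fixes h :: "complex \<Rightarrow> real" and g :: "real \<Rightarrow> real"
  assumes harm: "harmonic_on U h" and I: "open I"
    and U: "\<And>r \<phi>. 0 < r \<Longrightarrow> \<phi> \<in> I \<Longrightarrow> rcis r \<phi> \<in> U"
    and h: "\<And>r \<phi>. 0 < r \<Longrightarrow> \<phi> \<in> I \<Longrightarrow> h (rcis r \<phi>) = g \<phi> * r powr \<alpha>"
  shows "\<exists>g'. \<forall>\<phi>\<in>I. (g has_real_derivative g' \<phi>) (at \<phi>) \<and>
    (g' has_real_derivative - (\<alpha>\<^sup>2 * g \<phi>)) (at \<phi>)"
proof -
  define P where "P = partial_deriv 1 h"
  define Q where "Q = partial_deriv \<i> h"
  have oU: "open U"
    using harm by (simp add: harmonic_on_def C2_on_def)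
  have "h differentiable_on U" "P differentiable_on U" "Q differentiable_on U"
    using harm by (auto simp: harmonic_on_def C2_on_def P_def Q_def Basis_complex_def)
  then have dif: "h differentiable (at z)" "P differentiable (at z)" "Q differentiable (at z)"
    if "z \<in> U" for z
    using that oU by (auto simp: differentiable_on_eq_differentiable_at)
  have lap: "partial_deriv 1 P z + partial_deriv \<i> Q z = 0" if "z \<in> U" for z
    using harm that by (auto simp: harmonic_on_def laplacian_def Basis_complex_def P_def Q_def)
  \<comment> \<open>This is the angular derivative of \<open>h\<close> at radius 1; it can be
    differentiated again because \<open>P\<close> and \<open>Q\<close> can.\<close>
  define g' where "g' \<phi> = - sin \<phi> * P (cis \<phi>) + cos \<phi> * Q (cis \<phi>)" for \<phi>
  have "(g has_real_derivative g' \<phi>) (at \<phi>) \<and> (g' has_real_derivative - (\<alpha>\<^sup>2 * g \<phi>)) (at \<phi>)"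
    if \<phi>: "\<phi> \<in> I" for \<phi>
  proof
    have cU: "cis \<phi> \<in> U"
      using U[of 1 \<phi>] \<phi> by (simp add: rcis_def)
    have ang: "((\<lambda>t. k (cis t)) has_real_derivative
        - sin \<phi> * partial_deriv 1 k (cis \<phi>) + cos \<phi> * partial_deriv \<i> k (cis \<phi>)) (at \<phi>)"
      if "k differentiable (at (cis \<phi>))" for k :: "complex \<Rightarrow> real"
      using has_real_derivative_along_curve[OF that has_vector_derivative_cis]
      by (simp add: cos_add sin_add)
    have rad: "((\<lambda>t. k (rcis t \<phi>)) has_real_derivative
        cos \<phi> * partial_deriv 1 k (rcis r \<phi>) + sin \<phi> * partial_deriv \<i> k (rcis r \<phi>)) (at r)"
      if "k differentiable (at (rcis r \<phi>))" for k :: "complex \<Rightarrow> real" and r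
      using has_real_derivative_along_curve[OF that has_vector_derivative_rcis_radius]
      by simp
    have "((\<lambda>t. h (cis t)) has_real_derivative g' \<phi>) (at \<phi>)"
      using ang[OF dif(1)[OF cU]] by (simp add: g'_def P_def Q_def)
    then show "(g has_real_derivative g' \<phi>) (at \<phi>)"
      by (rule has_field_derivative_transform_within_open[OF _ I \<phi>]) (use h[of 1] in \<open>simp add: rcis_def\<close>)
    \<comment> \<open>The radial derivative is computed twice, from the partial derivatives and from
      the power law. Having it at every positive radius allows differentiating both sides in
      \<open>r\<close> at 1 next.\<close>
    have h_r: "cos \<phi> * P (rcis r \<phi>) + sin \<phi> * Q (rcis r \<phi>) = \<alpha> * g \<phi> * r powr (\<alpha> - 1)"
      if r: "0 < r" for r
    proof (rule DERIV_unique)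
      show "((\<lambda>t. h (rcis t \<phi>)) has_real_derivative
          cos \<phi> * P (rcis r \<phi>) + sin \<phi> * Q (rcis r \<phi>)) (at r)"
        using rad[OF dif(1)[OF U[OF r \<phi>]]] by (simp add: P_def Q_def)
      have "((\<lambda>t. g \<phi> * t powr \<alpha>) has_real_derivative \<alpha> * g \<phi> * r powr (\<alpha> - 1)) (at r)"
        using r by (auto intro!: derivative_eq_intros)
      then show "((\<lambda>t. h (rcis t \<phi>)) has_real_derivative \<alpha> * g \<phi> * r powr (\<alpha> - 1)) (at r)"
        by (rule has_field_derivative_transform_within_open[of _ _ _ "{0<..}"])
          (use h \<phi> r in auto)
    qed
    have h_rr: "cos \<phi> * (cos \<phi> * partial_deriv 1 P (cis \<phi>) + sin \<phi> * partial_deriv \<i> P (cis \<phi>))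
        + sin \<phi> * (cos \<phi> * partial_deriv 1 Q (cis \<phi>) + sin \<phi> * partial_deriv \<i> Q (cis \<phi>))
        = \<alpha> * (\<alpha> - 1) * g \<phi>"
    proof (rule DERIV_unique)
      show "((\<lambda>t. cos \<phi> * P (rcis t \<phi>) + sin \<phi> * Q (rcis t \<phi>)) has_real_derivative
          cos \<phi> * (cos \<phi> * partial_deriv 1 P (cis \<phi>) + sin \<phi> * partial_deriv \<i> P (cis \<phi>))
        + sin \<phi> * (cos \<phi> * partial_deriv 1 Q (cis \<phi>) + sin \<phi> * partial_deriv \<i> Q (cis \<phi>))) (at 1)"
        using rad[of P 1] rad[of Q 1] dif(2,3)[OF cU]
        by (intro DERIV_add DERIV_cmult) (simp_all add: rcis_def)
      have "((\<lambda>t. \<alpha> * g \<phi> * t powr (\<alpha> - 1)) has_real_derivative \<alpha> * (\<alpha> - 1) * g \<phi>) (at 1)"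
        by (auto intro!: derivative_eq_intros)
      then show "((\<lambda>t. cos \<phi> * P (rcis t \<phi>) + sin \<phi> * Q (rcis t \<phi>)) has_real_derivative
          \<alpha> * (\<alpha> - 1) * g \<phi>) (at 1)"
        by (rule has_field_derivative_transform_within_open[of _ _ _ "{0<..}"])
          (use h_r in auto)
    qed
    define X where "X = partial_deriv 1 P (cis \<phi>)"
    have Y: "partial_deriv \<i> Q (cis \<phi>) = - X"
      using lap[OF cU] by (simp add: X_def)
    have "(g' has_real_derivative
        - cos \<phi> * P (cis \<phi>) - sin \<phi> * (- sin \<phi> * X + cos \<phi> * partial_deriv \<i> P (cis \<phi>))
        - sin \<phi> * Q (cis \<phi>) + cos \<phi> * (- sin \<phi> * partial_deriv 1 Q (cis \<phi>) - cos \<phi> * X)) (at \<phi>)"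
      unfolding g'_def
      by (rule derivative_eq_intros ang[OF dif(2)[OF cU]] ang[OF dif(3)[OF cU]] refl)+
        (simp add: X_def[symmetric] Y)
    \<comment> \<open>The mixed partial derivatives enter both this expression and
      \<open>h_rr\<close> only through their sum, so \<open>h_rr\<close> eliminates them together.
      What remains is minus the first and second radial derivatives.\<close>
    moreover have "- cos \<phi> * P (cis \<phi>) - sin \<phi> * (- sin \<phi> * X + cos \<phi> * partial_deriv \<i> P (cis \<phi>))
        - sin \<phi> * Q (cis \<phi>) + cos \<phi> * (- sin \<phi> * partial_deriv 1 Q (cis \<phi>) - cos \<phi> * X)
        = - (\<alpha>\<^sup>2 * g \<phi>)"
      using h_r[of 1] h_rr unfolding Y X_def[symmetric]
      by (simp add: rcis_def algebra_simps power2_eq_square)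
    ultimately show "(g' has_real_derivative - (\<alpha>\<^sup>2 * g \<phi>)) (at \<phi>)" by simp
  qed
  then show ?thesis by blast
qed

text \<open>The phase vector (g, g'/\<alpha>) rotates at constant speed. Turning it back by the
  angle \<alpha>x gives the pair \<open>(a, b)\<close>, whose derivative vanishes, so it is constant
  on the connected set \<open>I\<close>; the inverse rotation recovers \<open>g\<close>.\<close>

lemma harmonic_oscillator_solution:
  fixes g g' :: "real \<Rightarrow> real"
  assumes "\<alpha> \<noteq> 0" and I: "open I" "Topological_Spaces.connected I"
    and g: "\<And>x. x \<in> I \<Longrightarrow> (g has_real_derivative g' x) (at x)"
    and g': "\<And>x. x \<in> I \<Longrightarrow> (g' has_real_derivative - (\<alpha>\<^sup>2 * g x)) (at x)"
  shows "\<exists>A B. \<forall>x\<in>I. g x = A * cos (\<alpha> * x) + B * sin (\<alpha> * x)"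
proof -
  define a where "a x = g x * cos (\<alpha> * x) - g' x / \<alpha> * sin (\<alpha> * x)" for x
  define b where "b x = g x * sin (\<alpha> * x) + g' x / \<alpha> * cos (\<alpha> * x)" for x
  have "(a has_real_derivative 0) (at x)" "(b has_real_derivative 0) (at x)" if "x \<in> I" for x
    unfolding a_def b_def using \<open>\<alpha> \<noteq> 0\<close>
    by (auto intro!: derivative_eq_intros g[OF that] g'[OF that]
        simp: field_simps power2_eq_square)
  then obtain A B where AB: "\<And>x. x \<in> I \<Longrightarrow> a x = A" "\<And>x. x \<in> I \<Longrightarrow> b x = B"
    using has_field_derivative_0_imp_constant_on[of I a] has_field_derivative_0_imp_constant_on[of I b] I
    unfolding constant_on_def by metis
  have "g x = A * cos (\<alpha> * x) + B * sin (\<alpha> * x)" if "x \<in> I" for x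
  proof -
    have "A * cos (\<alpha> * x) + B * sin (\<alpha> * x) = g x * (cos (\<alpha> * x) * cos (\<alpha> * x) + sin (\<alpha> * x) * sin (\<alpha> * x))"
      unfolding AB[OF that, symmetric] a_def b_def
      by (simp add: algebra_simps del: sin_cos_squared_add3)
    then show ?thesis by (simp only: sin_cos_squared_add3 mult_1_right)
  qed
  then show ?thesis by blast
qed

section \<open>The explicit formula on a face\<close>

text \<open>\<open>Arg\<close> is continuous off the nonpositive real axis, so the points there with
  argument strictly between 0 and \<open>\<theta>\<^sub>0\<close> form an open subset of the
  sector.\<close>

lemma rcis_in_interior_sector:
  assumes "0 < r" "0 < \<phi>" "\<phi> < \<theta>\<^sub>0" "\<theta>\<^sub>0 < pi"
  shows "rcis r \<phi> \<in> interior (sector \<theta>\<^sub>0)"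
proof (rule interiorI)
  let ?V = "{z \<in> - \<real>\<^sub>\<le>\<^sub>0. Arg z \<in> {0<..<\<theta>\<^sub>0}}"
  show "open ?V"
    using continuous_open_preimage[of "- \<real>\<^sub>\<le>\<^sub>0" Arg "{0<..<\<theta>\<^sub>0}"]
    by (auto simp: vimage_def Int_def continuous_on_Arg open_Compl intro: continuous_on_Arg)
  have "Im (rcis r \<phi>) > 0"
    using assms sin_gt_zero[of \<phi>] by simp
  then have "rcis r \<phi> \<notin> \<real>\<^sub>\<le>\<^sub>0"
    by (auto simp: complex_nonpos_Reals_iff)
  moreover have "Arg (rcis r \<phi>) = \<phi>"
    using assms by (simp add: Arg_rcis)
  ultimately show "rcis r \<phi> \<in> ?V"
    using assms by simp
  show "?V \<subseteq> sector \<theta>\<^sub>0"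
  proof
    fix z assume "z \<in> ?V"
    then show "z \<in> sector \<theta>\<^sub>0"
      unfolding sector_def
      by (intro CollectI exI[of _ "cmod z"] exI[of _ "Arg z"]) (auto simp: rcis_cmod_Arg)
  qed
qed

lemma edge_point_ends [simp]:
  "edge_point u v 0 = vertex_point u" "edge_point u v 1 = vertex_point v"
  by (auto simp: edge_point_def)

lemma edge_point_in_realization:
  "(u, v) \<in> parcs G \<Longrightarrow> 0 \<le> s \<Longrightarrow> s \<le> 1 \<Longrightarrow> edge_point u v s \<in> realization G"
  by (auto simp: realization_def)

lemma continuous_on_edge_point: "continuous_on S (edge_point u v)"
  unfolding edge_point_def by (intro continuous_on_coordinatewise_then_product continuous_intros)

text \<open>The values at the two ends of the edge fix the two coefficients: angle 0 gives the one
  of the cosine, and angle \<open>\<theta> {u, v}\<close> the one of the sine, after division by a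
  nonzero sine.\<close>

lemma homogeneous_harmonic_on_face:
  assumes uv: "(u, v) \<in> parcs G" "u \<in> pverts G" "v \<in> pverts G"
    and th: "0 < \<theta> {u, v}" "\<theta> {u, v} < pi"
    and sin: "sin (\<alpha> * \<theta> {u, v}) \<noteq> 0"
    and det: "determined_by G \<theta> \<alpha> \<rho> f"
    and r: "0 < r" and \<phi>: "\<phi> \<in> {0..\<theta> {u, v}}"
  shows "f (face_pt G \<theta> u v r \<phi>) = (\<rho> u * cos (\<alpha> * \<phi>) +
    (\<rho> v - cos (\<alpha> * \<theta> {u, v}) * \<rho> u) / sin (\<alpha> * \<theta> {u, v}) * sin (\<alpha> * \<phi>)) * r powr \<alpha>"
proof -
  let ?t = "\<theta> {u, v}"
  from det obtain \<sigma> where \<alpha>: "0 < \<alpha>" and \<sigma>: "continuous_on (realization G) \<sigma>"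
    and f: "\<And>x t. x \<in> realization G \<Longrightarrow> 0 \<le> t \<Longrightarrow> f (cone_pt G x t) = \<sigma> x * t powr \<alpha>"
    by (auto simp: determined_by_def homogeneous_def)
  have edge: "edge_point u v (x / ?t) \<in> realization G" if "x \<in> {0..?t}" for x
    using that th by (intro edge_point_in_realization uv) auto
  define g where "g x = \<sigma> (edge_point u v (x / ?t))" for x
  have fg: "f (face_pt G \<theta> u v s x) = g x * s powr \<alpha>" if "x \<in> {0..?t}" "0 < s" for x s
    unfolding face_pt_def g_def using that edge by (intro f) auto
  have "continuous_on {0..?t} (\<lambda>x. edge_point u v (x / ?t))"
    using th by (intro continuous_on_compose2[OF continuous_on_edge_point[of UNIV]] continuous_intros) auto
  then have cont: "continuous_on {0..?t} g"
    unfolding g_def using edge by (intro continuous_on_compose2[OF \<sigma>]) auto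
  \<comment> \<open>At height 1 the factor \<open>t powr \<alpha>\<close> is 1.\<close>
  have \<sigma>_vertex: "\<sigma> (vertex_point w) = \<rho> w" if "w \<in> pverts G" for w
    using det that f[of "vertex_point w" 1] by (auto simp: determined_by_def realization_def)
  have g_ends: "g 0 = \<rho> u" "g ?t = \<rho> v"
    using th by (auto simp: g_def \<sigma>_vertex uv)
  have "harmonic_on (interior (sector ?t)) (\<lambda>z. f (face_pt G \<theta> u v (cmod z) (Arg z)))"
    using det uv by (auto simp: determined_by_def harmonic_def)
  then have "\<exists>g'. \<forall>x\<in>{0<..<?t}. (g has_real_derivative g' x) (at x) \<and>
      (g' has_real_derivative - (\<alpha>\<^sup>2 * g x)) (at x)"
    using th by (intro homogeneous_harmonic_ode) (auto simp: Arg_rcis fg rcis_in_interior_sector)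
  then obtain g' where "\<And>x. x \<in> {0<..<?t} \<Longrightarrow> (g has_real_derivative g' x) (at x)"
      "\<And>x. x \<in> {0<..<?t} \<Longrightarrow> (g' has_real_derivative - (\<alpha>\<^sup>2 * g x)) (at x)"
    by blast
  then obtain A B where AB: "\<And>x. x \<in> {0<..<?t} \<Longrightarrow> g x = A * cos (\<alpha> * x) + B * sin (\<alpha> * x)"
    using harmonic_oscillator_solution[of \<alpha> "{0<..<?t}" g g'] \<alpha> by auto
  \<comment> \<open>Harmonicity speaks only of the interior of the sector; continuity of
    \<open>g\<close> carries the formula to the two boundary rays.\<close>
  have AB': "g x = A * cos (\<alpha> * x) + B * sin (\<alpha> * x)" if "x \<in> {0..?t}" for x
  proof -
    have "continuous_on (closure {0<..<?t}) (\<lambda>x. g x - (A * cos (\<alpha> * x) + B * sin (\<alpha> * x)))"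
      using cont th by (auto intro!: continuous_intros)
    from continuous_constant_on_closure[OF this, of 0 x]
    have "g x - (A * cos (\<alpha> * x) + B * sin (\<alpha> * x)) = 0"
      using AB that th by auto
    then show ?thesis by simp
  qed
  have "A = \<rho> u"
    using AB'[of 0] g_ends th by simp
  moreover have "B = (\<rho> v - cos (\<alpha> * ?t) * \<rho> u) / sin (\<alpha> * ?t)"
    using AB'[of ?t] g_ends th sin \<open>A = \<rho> u\<close> by (simp add: field_simps)
  ultimately show ?thesis
    using fg[OF \<phi> r] AB'[OF \<phi>] by simp
qed

section \<open>From the face formula to the vertex condition\<close>

theorem theorem3p1:
  fixes G :: "'v pair_pre_digraph" and \<theta> :: "'v set \<Rightarrow> real" and \<alpha> :: real
    and \<rho> :: "'v \<Rightarrow> real" and f :: "'v cone_point \<Rightarrow> real"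
  assumes "pair_graph G" and "Digraph_Component.connected (with_proj G)"
    and "\<And>e. e \<in> edge_set G \<Longrightarrow> 0 < \<theta> e \<and> \<theta> e < pi"
    and "0 < \<alpha>" and "\<not> singular_degree G \<theta> \<alpha>"
    and "determined_by G \<theta> \<alpha> \<rho> f"
  shows "balanced G \<theta> f \<longleftrightarrow>
    (\<forall>v\<in>pverts G.
      (\<Sum>w\<in>neighbours G v. (\<rho> w - cos (\<alpha> * \<theta> {v, w}) * \<rho> v) / sin (\<alpha> * \<theta> {v, w})) = 0)"
proof -
  interpret pair_graph G by fact
  define B where "B v w = (\<rho> w - cos (\<alpha> * \<theta> {v, w}) * \<rho> v) / sin (\<alpha> * \<theta> {v, w})" for v w
  \<comment> \<open>The equivalence holds for arbitrary \<open>D\<close>: it both supplies the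
    derivatives that \<open>balanced_along\<close> asks for and shows that no others are
    possible.\<close>
  have deriv: "((\<lambda>\<phi>. f (face_pt G \<theta> v w r \<phi>)) has_real_derivative D) (at 0 within {0..\<theta> {v, w}})
      \<longleftrightarrow> D = \<alpha> * r powr \<alpha> * B v w" if w: "w \<in> neighbours G v" and r: "0 < r" for v w r D
  proof -
    have vw: "(v, w) \<in> parcs G" "v \<in> pverts G" "w \<in> pverts G"
      using w by (auto simp: neighbours_def dest: in_arcsD1 in_arcsD2)
    have e: "{v, w} \<in> edge_set G"
      using vw by (auto simp: edge_set_def)
    then have th: "0 < \<theta> {v, w}" "\<theta> {v, w} < pi"
      using assms(3) by auto
    \<comment> \<open>The sine vanishes only at integer multiples of \<open>pi\<close>, which a
      non-singular degree excludes.\<close>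
    have "sin (\<alpha> * \<theta> {v, w}) \<noteq> 0"
      using assms(5) e by (auto simp: singular_degree_def sin_zero_iff_int2)
    note face = homogeneous_harmonic_on_face[OF vw th this assms(6) r, folded B_def]
    \<comment> \<open>The closed formula is differentiated in place of \<open>f\<close>; agreement
      on the interval is enough for a derivative within it.\<close>
    have "((\<lambda>\<phi>. (\<rho> v * cos (\<alpha> * \<phi>) + B v w * sin (\<alpha> * \<phi>)) * r powr \<alpha>) has_real_derivative
        \<alpha> * r powr \<alpha> * B v w) (at 0 within {0..\<theta> {v, w}})"
      by (auto intro!: derivative_eq_intros)
    then have d: "((\<lambda>\<phi>. f (face_pt G \<theta> v w r \<phi>)) has_real_derivative \<alpha> * r powr \<alpha> * B v w)
        (at 0 within {0..\<theta> {v, w}})"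
      by (rule has_field_derivative_transform_within[OF _ zero_less_one]) (use th face in auto)
    \<comment> \<open>One-sided derivatives are unique because 0 is a limit point of this
      nondegenerate interval.\<close>
    have "at 0 within {0..\<theta> {v, w}} \<noteq> bot"
      using th by (simp add: trivial_limit_within islimpt_Icc)
    with d show ?thesis
      by (auto dest: has_field_derivative_unique)
  qed
  have "balanced_along G \<theta> f v \<longleftrightarrow> (\<Sum>w\<in>neighbours G v. B v w) = 0" for v
  proof
    assume "balanced_along G \<theta> f v"
    \<comment> \<open>At radius 1 the factor \<open>r powr \<alpha>\<close> is 1, which leaves only
      the positive \<alpha> to cancel.\<close>
    then obtain D where "\<forall>w\<in>neighbours G v. D w = \<alpha> * B v w" "(\<Sum>w\<in>neighbours G v. D w) = 0"
      using deriv[of _ v 1] by (auto simp: balanced_along_def dest!: spec[of _ 1])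
    then have "\<alpha> * (\<Sum>w\<in>neighbours G v. B v w) = 0"
      by (simp add: sum_distrib_left)
    with \<open>0 < \<alpha>\<close> show "(\<Sum>w\<in>neighbours G v. B v w) = 0" by simp
  next
    assume "(\<Sum>w\<in>neighbours G v. B v w) = 0"
    \<comment> \<open>All angular derivatives at radius \<open>r\<close> share the factor
      \<open>\<alpha> * r powr \<alpha>\<close>, so the one vertex condition gives balance at every
      radius.\<close>
    then have "(\<Sum>w\<in>neighbours G v. \<alpha> * r powr \<alpha> * B v w) = 0" for r
      by (simp add: sum_distrib_left[symmetric])
    then show "balanced_along G \<theta> f v"
      unfolding balanced_along_def using deriv
      by (intro allI impI exI[of _ "\<lambda>w. \<alpha> * _ powr \<alpha> * B v w"]) auto
  qed
  then show ?thesis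
    by (simp add: balanced_def B_def)
qed

end
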